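(* Let $(\Theta,\mathcal{T})$ be a measurable space, $\pi\in\mathcal{P}(\Theta)$, $\eta>0$, let $(\ell_t)_{t\in\mathbb{N}}$ be a sequence of $\mathcal{T}$-measurable functions $\ell_t:\Theta\to\mathbb{R}_+$, and let $\phi:\mathbb{R}_+\to\mathbb{R}\cup\{+\infty\}$ be strictly convex with $\phi(1)=0$ and $\inf_{x\ge 0}\phi(x)>-\infty$. Let $M\subseteq\mathbb{R}^d$ be a closed convex set and $(q_\mu)_{\mu\in M}$ a family of probability distributions in $\mathcal{P}(\Theta)$. Let $(\mu_t)_{t\ge 1}$ be the sequence in $M$ defined recursively by $$\mu_t=\operatorname*{argmin}_{\mu\in M}\left\{\sum_{s=1}^{t-1}\left\langle\mu,\nabla_{\mu=\mu_s}\mathbb{E}_{\theta\sim q_\mu}[\ell_s(\theta)]\right\rangle+\frac{D_\phi(q_\mu\|\pi)}{\eta}\right\}.$$ Let $\|\cdot\|$ be a norm on $\mathbb{R}^d$ and let $L,\alpha>0$. If each $\mu\mapsto\mathbb{E}_{\theta\sim q_\mu}[\ell_s(\theta)]$ is convex and $L$-Lipschitz with respect to $\|\cdot\|$, and if $\mu\mapsto D_\phi(q_\mu\|\pi)$ is $\alpha$-strongly convex with respect to $\|\cdot\|$, then for every $T\ge1$, $$\sum_{t=1}^T\mathbb{E}_{\theta\sim q_{\mu_t}}[\ell_t(\theta)]\le\inf_{\mu\in M}\left\{\sum_{t=1}^T\mathbb{E}_{\theta\sim q_\mu}[\ell_t(\theta)]+\frac{\eta L^2T}{\alpha}+\fr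ac{D_\phi(q_\mu\|\pi)}{\eta}\right\}.$$
   Context: $\mathcal{P}(\Theta)$ is the set of all probability distributions on $(\Theta,\mathcal{T})$. The $\phi$-divergence is $D_\phi(\rho\|\pi)=\mathbb{E}_{\theta\sim\pi}\left[\phi\left(\frac{d\rho}{d\pi}(\theta)\right)\right]$ if $\rho\ll\pi$, and $+\infty$ otherwise. The notation $\nabla_{\mu=\mu_s}\mathbb{E}_{\theta\sim q_\mu}[\ell_s(\theta)]$ denotes the gradient of the function $\mu\mapsto\mathbb{E}_{\theta\sim q_\mu}[\ell_s(\theta)]$ evaluated at $\mu=\mu_s$, and $\langle\cdot,\cdot\rangle$ is the standard inner product of $\mathbb{R}^d$. A function $\varphi$ is $\alpha$-strongly convex with respect to $\|\cdot\|$ when for all $u,v$ in its (convex) domain and all $\gamma\in[0,1]$, $\varphi(\gamma u+(1-\gamma)v)\le\gamma\varphi(u)+(1-\gamma)\varphi(v)-\frac{\alpha}{2}\gamma(1-\gamma)\|u-v\|^2$. *)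

theory Defs
  imports "HOL-Probability.Probability"
begin

(* The expectation of a random variable with values in [-\<infinity>, \<infinity>]: e2ennreal cuts negative
   values off at 0, so the two integrals are those of the positive and of the negative part.
   The value is meaningful when one of them is finite, e.g. when X is bounded below and M is a
   probability measure. *)
definition ereal_expectation :: "'a measure \<Rightarrow> ('a \<Rightarrow> ereal) \<Rightarrow> ereal" where
  "ereal_expectation M X =
     enn2ereal (\<integral>\<^sup>+\<theta>. e2ennreal (X \<theta>) \<partial>M) - enn2ereal (\<integral>\<^sup>+\<theta>. e2ennreal (- X \<theta>) \<partial>M)"

(* phi is only evaluated on [0, \<infinity>). The density is almost everywhere finite if \<rho> is a
   probability measure, so enn2real changes it on a null set at most. *)
definition phi_divergence :: "(real \<Rightarrow> ereal) \<Rightarrow> 'a measure \<Rightarrow> 'a measure \<Rightarrow> ereal" where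
  "phi_divergence \<phi> \<rho> \<pi> =
     (if absolutely_continuous \<pi> \<rho>
      then ereal_expectation \<pi> (\<lambda>\<theta>. \<phi> (enn2real (RN_deriv \<pi> \<rho> \<theta>)))
      else \<infinity>)"

(* Strict convexity on S of a function with values in (-\<infinity>, \<infinity>]. If f is infinite at one of the
   two points, the right-hand side is infinite and the (weak) inequality holds trivially; strictness
   is required on the effective domain only, as usual for extended-valued functions. *)
definition ereal_strictly_convex_on :: "'v::real_vector set \<Rightarrow> ('v \<Rightarrow> ereal) \<Rightarrow> bool" where
  "ereal_strictly_convex_on S f \<longleftrightarrow>
     convex S \<and> (\<forall>x\<in>S. f x \<noteq> -\<infinity>) \<and>
     (\<forall>x\<in>S. \<forall>y\<in>S. \<forall>\<gamma>. x \<noteq> y \<and> f x < \<infinity> \<and> f y < \<infinity> \<and> 0 < \<gamma> \<and> \<gamma> < 1 \<longrightarrow>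
        f (\<gamma> *\<^sub>R x + (1 - \<gamma>) *\<^sub>R y) < ereal \<gamma> * f x + ereal (1 - \<gamma>) * f y)"

definition is_norm :: "('v::real_vector \<Rightarrow> real) \<Rightarrow> bool" where
  "is_norm N \<longleftrightarrow>
     (\<forall>x. N x = 0 \<longleftrightarrow> x = 0) \<and>
     (\<forall>c x. N (c *\<^sub>R x) = \<bar>c\<bar> * N x) \<and>
     (\<forall>x y. N (x + y) \<le> N x + N y)"

definition lipschitz_wrt ::
    "('v::real_vector \<Rightarrow> real) \<Rightarrow> real \<Rightarrow> 'v set \<Rightarrow> ('v \<Rightarrow> real) \<Rightarrow> bool" where
  "lipschitz_wrt N L S f \<longleftrightarrow> (\<forall>u\<in>S. \<forall>v\<in>S. \<bar>f u - f v\<bar> \<le> L * N (u - v))"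

(* For f with values in (-\<infinity>, \<infinity>]. The inequality is trivial where its right-hand side is
   infinite, so this is strong convexity on the effective domain of f (convex as a consequence).
   Note 0 * \<infinity> = 0 in ereal, so \<gamma> = 0 and \<gamma> = 1 are harmless. *)
definition ereal_strongly_convex_on ::
    "('v::real_vector \<Rightarrow> real) \<Rightarrow> real \<Rightarrow> 'v set \<Rightarrow> ('v \<Rightarrow> ereal) \<Rightarrow> bool" where
  "ereal_strongly_convex_on N \<alpha> S f \<longleftrightarrow>
     convex S \<and>
     (\<forall>u\<in>S. \<forall>v\<in>S. \<forall>\<gamma>\<in>{0..1}.
        f (\<gamma> *\<^sub>R u + (1 - \<gamma>) *\<^sub>R v)
          \<le> ereal \<gamma> * f u + ereal (1 - \<gamma>) * f v
             - ereal (\<alpha> / 2 * \<gamma> * (1 - \<gamma>) * (N (u - v))\<^sup>2))"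

(* GDERIV relative to a set. For x in the interior of S this is GDERIV f x :> g. At boundary points
   it is the gradient of a function that is defined on S only; if S has empty interior, g is
   determined only up to vectors orthogonal to the affine hull of S. *)
definition has_gradient_within :: "('v::real_inner \<Rightarrow> real) \<Rightarrow> 'v \<Rightarrow> 'v \<Rightarrow> 'v set \<Rightarrow> bool" where
  "has_gradient_within f g x S \<longleftrightarrow> (f has_derivative (\<lambda>h. inner h g)) (at x within S)"

end

theory Submission
  imports Defs
begin

text \<open>The updates follow the regularized leader on linearized losses. On the effective domain of the
  divergence the objective is \<open>\<alpha> / \<eta>\<close>-strongly convex, so it grows quadratically around its
  minimizer. Comparing the minima of consecutive objectives, the growth term absorbs the linear loss
  of one step, which costs at most \<open>\<eta> L\<^sup>2 / (2 \<alpha>)\<close>; telescoping leaves the divergence of the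
  comparator minus that of \<open>\<mu> 1\<close>, and the latter is nonnegative by Jensen's inequality.\<close>

section \<open>Nonnegativity of the divergence\<close>

text \<open>The positive and negative parts are compared separately; integrability of
  \<open>h\<close> keeps both of its parts finite, so no infinite difference arises. Since
  \<open>nn_integral_mono_AE\<close> holds for arbitrary functions, the bound applies directly to
  compositions with \<phi>.\<close>

lemma ereal_expectation_ge_integral:
  fixes h :: "'a \<Rightarrow> real"
  assumes h: "integrable M h" and le: "AE x in M. ereal (h x) \<le> X x"
  shows "ereal (\<integral>x. h x \<partial>M) \<le> ereal_expectation M X"
proof -
  have pos: "(\<integral>\<^sup>+x. ennreal (h x) \<partial>M) \<le> (\<integral>\<^sup>+x. e2ennreal (X x) \<partial>M)"
    by (rule nn_integral_mono_AE, use le in eventually_elim) (metis e2ennreal_ereal e2ennreal_mono)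
  have neg: "(\<integral>\<^sup>+x. e2ennreal (- X x) \<partial>M) \<le> (\<integral>\<^sup>+x. ennreal (- h x) \<partial>M)"
    by (rule nn_integral_mono_AE, use le in eventually_elim)
      (metis e2ennreal_ereal e2ennreal_mono ereal_minus_le_minus uminus_ereal.simps(1))
  have fin: "(\<integral>\<^sup>+x. ennreal (h x) \<partial>M) < \<infinity>" "(\<integral>\<^sup>+x. ennreal (- h x) \<partial>M) < \<infinity>"
    using h by (auto simp: real_integrable_def less_top)
  have toreal: "ereal (enn2real x) = enn2ereal x" if "x < \<infinity>" for x
    using that by (cases x) auto
  have "ereal (\<integral>x. h x \<partial>M)
      = enn2ereal (\<integral>\<^sup>+x. ennreal (h x) \<partial>M) - enn2ereal (\<integral>\<^sup>+x. ennreal (- h x) \<partial>M)"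
    by (simp add: real_lebesgue_integral_def[OF h] fin[THEN toreal, symmetric])
  also have "\<dots> \<le> ereal_expectation M X"
    unfolding ereal_expectation_def using pos neg
    by (intro ereal_minus_mono) (simp_all add: less_eq_ennreal.rep_eq)
  finally show ?thesis .
qed

text \<open>An infinite value on a set of positive measure outweighs a finite lower bound: a real
  minorant of \<open>X\<close> can be raised on \<open>A\<close> at will, until its integral is
  0.\<close>

lemma ereal_expectation_nonneg_if_infinite_on:
  assumes "prob_space M" and A: "A \<in> sets M" "measure M A > 0"
    and inf: "\<And>x. x \<in> A \<Longrightarrow> X x = \<infinity>" and bound: "\<And>x. x \<in> space M \<Longrightarrow> ereal b \<le> X x"
  shows "0 \<le> ereal_expectation M X"
proof -
  interpret prob_space M by fact
  \<comment> \<open>Off \<open>A\<close> this is the bound \<open>b\<close>; the correction on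
    \<open>A\<close>, where \<open>X\<close> is infinite, is scaled to make the integral exactly
    0.\<close>
  define h where "h = (\<lambda>x. b - b / measure M A * indicator A x :: real)"
  have ind: "integrable M (\<lambda>x. b / measure M A * indicator A x)"
    using A by (intro integrable_mult_right integrable_real_indicator) (auto simp: emeasure_eq_measure)
  hence h: "integrable M h"
    unfolding h_def by (intro Bochner_Integration.integrable_diff) auto
  have "ereal (h x) \<le> X x" if "x \<in> space M" for x
    using bound[OF that] inf[of x] by (cases "x \<in> A") (auto simp: h_def)
  hence "ereal (\<integral>x. h x \<partial>M) \<le> ereal_expectation M X"
    by (intro ereal_expectation_ge_integral h AE_I2)
  moreover have "(\<integral>x. h x \<partial>M) = b - b / measure M A * measure M A"
    unfolding h_def using sets.sets_into_space[OF A(1)]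
    by (subst Bochner_Integration.integral_diff[OF _ ind]) (simp_all add: prob_space Int_absorb2)
  ultimately show ?thesis using A(2) by (simp add: zero_ereal_def)
qed

text \<open>If \<open>\<phi>\<close> is finite on both sides of 1, it has an affine minorant through \<open>(1, 0)\<close>. Otherwise
  1 is an endpoint of its effective domain, where the subdifferential may be empty; but then
  \<open>f\<close> cannot leave 1 on that side, and hence not at all, unless the expectation is infinite.\<close>

lemma ereal_expectation_convex_nonneg:
  fixes \<phi> :: "real \<Rightarrow> ereal" and f :: "'a \<Rightarrow> real"
  assumes "prob_space M" and f: "integrable M f" "\<And>x. x \<in> space M \<Longrightarrow> 0 \<le> f x"
    and mean: "(\<integral>x. f x \<partial>M) = 1"
    and cvx: "ereal_strictly_convex_on {0..} \<phi>" and one: "\<phi> 1 = 0"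
    and bound: "\<And>x. 0 \<le> x \<Longrightarrow> ereal b \<le> \<phi> x"
  shows "0 \<le> ereal_expectation M (\<lambda>x. \<phi> (f x))"
proof -
  interpret prob_space M by fact
  have [measurable]: "f \<in> borel_measurable M" using f(1) by simp
  have const: "0 \<le> ereal_expectation M (\<lambda>x. \<phi> (f x))" if "AE x in M. f x = 1"
  proof -
    have "AE x in M. ereal 0 \<le> \<phi> (f x)"
      using that by eventually_elim (simp add: one)
    thus ?thesis
      using ereal_expectation_ge_integral[of M "\<lambda>_. 0" "\<lambda>x. \<phi> (f x)"]
      by (simp add: zero_ereal_def)
  qed
  \<comment> \<open>The sign of \<sigma> selects the side of 1 on which \<phi> is infinite: left for
    \<open>\<sigma> = 1\<close>, right for \<open>\<sigma> = -1\<close>.\<close>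
  have one_sided: "0 \<le> ereal_expectation M (\<lambda>x. \<phi> (f x))"
    if \<sigma>: "\<sigma> \<noteq> 0" and inf: "\<And>x. 0 \<le> x \<Longrightarrow> \<sigma> * (x - 1) < 0 \<Longrightarrow> \<phi> x = \<infinity>" for \<sigma> :: real
  proof -
    define A where "A = {x \<in> space M. \<sigma> * (f x - 1) < 0}"
    have A: "A \<in> sets M" unfolding A_def by measurable
    show ?thesis
    proof (cases "measure M A > 0")
      case True
      then show ?thesis
        using inf f(2) bound
        by (intro ereal_expectation_nonneg_if_infinite_on[OF assms(1) A, of _ b]) (auto simp: A_def)
    next
      case False
      hence "prob A = 0" using measure_nonneg[of M A] by linarith
      hence ae: "AE x in M. 0 \<le> \<sigma> * (f x - 1)"
        using prob_eq_0[OF A] by (auto simp: A_def not_less)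
      \<comment> \<open>Here \<open>f\<close> stays almost surely on one side of its mean, so the
        nonnegative function \<open>\<sigma> * (f x - 1)\<close> has integral 0 and vanishes almost
        everywhere.\<close>
      have "(\<integral>x. \<sigma> * (f x - 1) \<partial>M) = 0" using f(1) mean by (simp add: prob_space)
      hence "AE x in M. \<sigma> * (f x - 1) = 0"
        using integral_nonneg_eq_0_iff_AE[OF _ ae] f(1) by auto
      thus ?thesis using \<sigma> by (intro const) auto
    qed
  qed
  show ?thesis
  proof (cases "(\<exists>a. 0 \<le> a \<and> a < 1 \<and> \<phi> a < \<infinity>) \<and> (\<exists>c. 1 < c \<and> \<phi> c < \<infinity>)")
    case True
    then obtain a c where a: "0 \<le> a" "a < 1" "\<phi> a < \<infinity>" and c: "1 < c" "\<phi> c < \<infinity>" by auto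
    define I where "I = {x. 0 \<le> x \<and> \<phi> x < \<infinity>}"
    define r where "r = (\<lambda>x. real_of_ereal (\<phi> x))"
    have r: "\<phi> x = ereal (r x)" if "x \<in> I" for x
      using bound[of x] that by (cases "\<phi> x") (auto simp: I_def r_def)
    have comb: "u * x + v * y \<in> I \<and> r (u * x + v * y) \<le> u * r x + v * r y"
      if I: "x \<in> I" "y \<in> I" and uv: "0 < u" "0 < v" "u + v = 1" for x y u v
    proof (cases "x = y")
      case True
      then show ?thesis using I uv by (simp flip: distrib_right)
    next
      case False
      have v: "v = 1 - u" using uv by simp
      have "\<phi> (u * x + v * y) < ereal u * \<phi> x + ereal v * \<phi> y"
        using cvx I uv False unfolding ereal_strictly_convex_on_def I_def v by auto
      hence lt: "\<phi> (u * x + v * y) < ereal (u * r x + v * r y)"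
        using r[OF I(1)] r[OF I(2)] by simp
      moreover from lt have mem: "u * x + v * y \<in> I"
        using I uv unfolding I_def by (auto intro: less_trans)
      ultimately show ?thesis using r[OF mem] by simp
    qed
    have "convex I"
      unfolding convex_def
    proof (intro ballI allI impI)
      fix x y u v :: real assume "x \<in> I" "y \<in> I" "0 \<le> u" "0 \<le> v" "u + v = 1"
      then show "u *\<^sub>R x + v *\<^sub>R y \<in> I"
        using comb[of x y u v] by (cases "u = 0"; cases "v = 0") auto
    qed
    hence cr: "convex_on I r"
      using comb by (intro convex_onI) auto
    have ac: "a \<in> I" "c \<in> I" using a c by (auto simp: I_def)
    have "{a..c} \<subseteq> I"
      using \<open>convex I\<close> ac a(2) c(1)
      by (metis closed_segment_eq_real_ivl convex_contains_segment less_trans less_imp_le)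
    hence int: "1 \<in> interior I"
      using a c interior_mono[of "{a..c}" I] by (auto simp: interior_atLeastAtMost_real)
    \<comment> \<open>The right derivative of \<open>r\<close> at 1, as the infimum of the slopes to
      the right. It is a subgradient since 1 is interior to \<open>I\<close>, and the resulting
      affine minorant integrates to 0 because \<open>f\<close> has mean 1.\<close>
    define s where "s = Inf ((\<lambda>t. (r 1 - r t) / (1 - t)) ` ({1<..} \<inter> I))"
    have sub: "ereal (s * (y - 1)) \<le> \<phi> y" if "0 \<le> y" for y
    proof (cases "\<phi> y < \<infinity>")
      case True
      hence y: "y \<in> I" using that by (simp add: I_def)
      have "r y \<ge> r 1 + s * (y - 1)"
        unfolding s_def by (rule convex_le_Inf_differential[OF cr int y])
      moreover have "r 1 = 0" by (simp add: r_def one)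
      ultimately show ?thesis by (simp add: r[OF y])
    qed auto
    have "ereal (\<integral>x. s * (f x - 1) \<partial>M) \<le> ereal_expectation M (\<lambda>x. \<phi> (f x))"
      using f sub by (intro ereal_expectation_ge_integral AE_I2) auto
    thus ?thesis using f(1) mean by (simp add: prob_space zero_ereal_def)
  next
    case False
    then consider "\<And>x. 0 \<le> x \<Longrightarrow> x < 1 \<Longrightarrow> \<phi> x = \<infinity>" | "\<And>x. 1 < x \<Longrightarrow> \<phi> x = \<infinity>"
      by auto
    then show ?thesis
      using one_sided[of 1] one_sided[of "-1"] by cases auto
  qed
qed

text \<open>Jensen's inequality for the density, whose mean under \<pi> is the total mass 1 of
  \<rho>.\<close>

lemma phi_divergence_nonneg:
  assumes "prob_space \<pi>" "prob_space \<rho>" and sets: "sets \<rho> = sets \<pi>"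
    and cvx: "ereal_strictly_convex_on {0..} \<phi>" and one: "\<phi> 1 = 0"
    and bound: "(INF x\<in>{0..}. \<phi> x) > -\<infinity>"
  shows "0 \<le> phi_divergence \<phi> \<rho> \<pi>"
proof (cases "absolutely_continuous \<pi> \<rho>")
  case ac: True
  interpret P: prob_space \<pi> by fact
  interpret R: prob_space \<rho> by fact
  define f where "f = (\<lambda>x. enn2real (RN_deriv \<pi> \<rho> x))"
  have [measurable]: "f \<in> borel_measurable \<pi>" unfolding f_def by measurable
  \<comment> \<open>Finiteness almost everywhere ensures that \<open>enn2real\<close> loses no
    mass.\<close>
  have "AE x in \<pi>. RN_deriv \<pi> \<rho> x \<noteq> \<infinity>"
    using ac sets by (intro P.RN_deriv_finite) unfold_locales
  hence "(\<integral>\<^sup>+x. ennreal (f x) \<partial>\<pi>) = (\<integral>\<^sup>+x. RN_deriv \<pi> \<rho> x \<partial>\<pi>)"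
    by (intro nn_integral_cong_AE, eventually_elim) (simp add: f_def less_top)
  also have "\<dots> = emeasure (density \<pi> (RN_deriv \<pi> \<rho>)) (space \<pi>)"
    by (subst emeasure_density) (auto intro!: nn_integral_cong)
  also have "\<dots> = 1"
    using P.density_RN_deriv[OF ac sets] R.emeasure_space_1 sets_eq_imp_space_eq[OF sets] by simp
  finally have nn: "(\<integral>\<^sup>+x. ennreal (f x) \<partial>\<pi>) = ennreal 1" by simp
  have f0: "0 \<le> f x" for x by (simp add: f_def)
  have f: "integrable \<pi> f"
    using nn f0 by (intro integrableI_nn_integral_finite) auto
  have mean: "(\<integral>x. f x \<partial>\<pi>) = 1"
    using nn f0 by (subst integral_eq_nn_integral) auto
  obtain b where b: "ereal b < (INF x\<in>{0..}. \<phi> x)"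
    using bound ereal_dense2 by blast
  have "ereal b \<le> \<phi> x" if "0 \<le> x" for x
    using b INF_lower[of x "{0..}" \<phi>] that by auto
  hence "0 \<le> ereal_expectation \<pi> (\<lambda>x. \<phi> (f x))"
    using f f0 mean cvx one by (intro ereal_expectation_convex_nonneg) (auto intro: P.prob_space_axioms)
  then show ?thesis using ac by (simp add: phi_divergence_def f_def)
qed (simp add: phi_divergence_def)

section \<open>First-order bounds along segments\<close>

text \<open>Convexity keeps the segment from \<open>x\<close> to \<open>y\<close> inside
  \<open>S\<close>, so the chain rule along it gives a one-sided directional derivative even if
  \<open>x\<close> is a boundary point or \<open>S\<close> has empty interior.\<close>

lemma has_gradient_within_directional:
  assumes grad: "has_gradient_within f g x S" and S: "convex S" "x \<in> S" "y \<in> S"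
  shows "((\<lambda>\<gamma>. (f (x + \<gamma> *\<^sub>R (y - x)) - f x) / \<gamma>) \<longlongrightarrow> inner (y - x) g) (at_right 0)"
proof -
  have sub: "(\<lambda>\<gamma>. x + \<gamma> *\<^sub>R (y - x)) ` {0..1} \<subseteq> S"
  proof clarify
    fix \<gamma> :: real assume "\<gamma> \<in> {0..1}"
    then show "x + \<gamma> *\<^sub>R (y - x) \<in> S"
      using convexD[OF S, of "1 - \<gamma>" \<gamma>] by (simp add: algebra_simps)
  qed
  have path: "((\<lambda>\<gamma>. x + \<gamma> *\<^sub>R (y - x)) has_derivative (\<lambda>\<gamma>. \<gamma> *\<^sub>R (y - x))) (at 0 within {0..1::real})"
    by (auto intro!: derivative_eq_intros)
  have "((\<lambda>\<gamma>. f (x + \<gamma> *\<^sub>R (y - x))) has_derivative (\<lambda>\<gamma>. inner (\<gamma> *\<^sub>R (y - x)) g)) (at 0 within {0..1::real})"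
    using grad sub unfolding has_gradient_within_def
    by (intro has_derivative_in_compose[OF path]) (auto intro: has_derivative_subset)
  hence "((\<lambda>\<gamma>. f (x + \<gamma> *\<^sub>R (y - x))) has_field_derivative inner (y - x) g) (at 0 within {0..1})"
    unfolding has_field_derivative_def by (simp add: mult.commute[of _ "inner (y - x) g"])
  thus ?thesis
    by (simp add: has_field_derivative_iff at_within_Icc_at_right)
qed

lemma eventually_at_right_0_unit_interval: "\<forall>\<^sub>F \<gamma> in at_right (0::real). 0 < \<gamma> \<and> \<gamma> < 1"
  by (auto simp: eventually_at_right_field intro: exI[of _ 1])

text \<open>By convexity every difference quotient along the segment is at most
  \<open>f y - f x\<close>; the inequality passes to the limit at \<open>x\<close>.\<close>

lemma convex_on_gradient_ineq:
  assumes grad: "has_gradient_within f g x S" and f: "convex_on S f" and xy: "x \<in> S" "y \<in> S"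
  shows "inner (y - x) g \<le> f y - f x"
proof (rule tendsto_upperbound)
  show "((\<lambda>\<gamma>. (f (x + \<gamma> *\<^sub>R (y - x)) - f x) / \<gamma>) \<longlongrightarrow> inner (y - x) g) (at_right 0)"
    using has_gradient_within_directional[OF grad convex_on_imp_convex[OF f] xy] .
  show "\<forall>\<^sub>F \<gamma> in at_right 0. (f (x + \<gamma> *\<^sub>R (y - x)) - f x) / \<gamma> \<le> f y - f x"
    using eventually_at_right_0_unit_interval
  proof eventually_elim
    case (elim \<gamma>)
    have "f ((1 - \<gamma>) *\<^sub>R x + \<gamma> *\<^sub>R y) \<le> (1 - \<gamma>) * f x + \<gamma> * f y"
      using convex_onD[OF f, of \<gamma> x y] elim xy by auto
    moreover have "x + \<gamma> *\<^sub>R (y - x) = (1 - \<gamma>) *\<^sub>R x + \<gamma> *\<^sub>R y"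
      by (simp add: algebra_simps)
    ultimately show ?case using elim by (simp add: field_simps)
  qed
qed simp

text \<open>Homogeneity of \<open>N\<close> bounds the difference quotients along the segment. Only
  directions into \<open>S\<close> are covered: a dual-norm bound on \<open>g\<close> can fail when
  \<open>S\<close> has empty interior, since \<open>g\<close> is then not unique.\<close>

lemma lipschitz_wrt_gradient_bound:
  assumes grad: "has_gradient_within f g x S" and f: "lipschitz_wrt N L S f" and N: "is_norm N"
    and S: "convex S" "x \<in> S" "y \<in> S"
  shows "- L * N (y - x) \<le> inner (y - x) g"
proof (rule tendsto_lowerbound)
  show "((\<lambda>\<gamma>. (f (x + \<gamma> *\<^sub>R (y - x)) - f x) / \<gamma>) \<longlongrightarrow> inner (y - x) g) (at_right 0)"
    using has_gradient_within_directional[OF grad S] .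
  show "\<forall>\<^sub>F \<gamma> in at_right 0. - L * N (y - x) \<le> (f (x + \<gamma> *\<^sub>R (y - x)) - f x) / \<gamma>"
    using eventually_at_right_0_unit_interval
  proof eventually_elim
    case (elim \<gamma>)
    have "x + \<gamma> *\<^sub>R (y - x) \<in> S"
      using convexD[OF S, of "1 - \<gamma>" \<gamma>] elim by (simp add: algebra_simps)
    hence "\<bar>f (x + \<gamma> *\<^sub>R (y - x)) - f x\<bar> \<le> L * N (\<gamma> *\<^sub>R (y - x))"
      using f S(2) unfolding lipschitz_wrt_def by (metis add_diff_cancel_left')
    also have "\<dots> = L * (\<gamma> * N (y - x))"
      using N elim by (simp add: is_norm_def)
    finally show ?case using elim by (simp add: field_simps abs_le_iff)
  qed
qed simp

section \<open>Follow the regularized leader\<close>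

text \<open>Here \<open>a\<close> is a minimum, \<open>b\<close> the value at another point and
  \<open>c\<close> the curvature term between them. Dividing by \<gamma> leaves
  \<open>(1 - \<gamma>) * c \<le> b - a\<close>, and \<gamma> tends to 0.\<close>

lemma strongly_convex_minimum_growth:
  fixes a b c :: real
  assumes "\<And>\<gamma>. 0 < \<gamma> \<Longrightarrow> \<gamma> < 1 \<Longrightarrow> a \<le> \<gamma> * b + (1 - \<gamma>) * a - \<gamma> * (1 - \<gamma>) * c"
  shows "a + c \<le> b"
proof -
  have "((\<lambda>\<gamma>. (1 - \<gamma>) * c) \<longlongrightarrow> (1 - 0) * c) (at_right 0)"
    by (intro tendsto_intros)
  moreover have "\<forall>\<^sub>F \<gamma> in at_right 0. (1 - \<gamma>) * c \<le> b - a"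
    using eventually_at_right_0_unit_interval
  proof eventually_elim
    case (elim \<gamma>)
    have "\<gamma> * ((1 - \<gamma>) * c) \<le> \<gamma> * (b - a)"
      using assms[of \<gamma>] elim by (simp add: algebra_simps)
    thus ?case using elim by simp
  qed
  ultimately have "(1 - 0) * c \<le> b - a"
    by (rule tendsto_upperbound) simp
  thus ?thesis by simp
qed

text \<open>Passing from one minimum to the next accounts for the newest linear loss up to a fixed
  error; the sum of these steps telescopes.\<close>

lemma ftrl_linear_regret:
  fixes g \<mu> :: "nat \<Rightarrow> 'v::real_inner" and R :: "'v \<Rightarrow> real"
  assumes \<beta>: "\<beta> > 0" and mem: "\<And>t. t \<ge> 1 \<Longrightarrow> \<mu> t \<in> S"
    and growth: "\<And>t y. t \<ge> 1 \<Longrightarrow> y \<in> S \<Longrightarrow>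
      (\<Sum>s = 1..<t. inner (\<mu> t) (g s)) + R (\<mu> t) + \<beta> / 2 * (N (y - \<mu> t))\<^sup>2
        \<le> (\<Sum>s = 1..<t. inner y (g s)) + R y"
    and grad: "\<And>t y. t \<ge> 1 \<Longrightarrow> y \<in> S \<Longrightarrow> - L * N (y - \<mu> t) \<le> inner (y - \<mu> t) (g t)"
    and y: "y \<in> S"
  shows "(\<Sum>t = 1..T. inner (\<mu> t - y) (g t)) \<le> R y - R (\<mu> 1) + real T * (L\<^sup>2 / (2 * \<beta>))"
proof -
  \<comment> \<open>\<open>F t\<close> contains the losses before round \<open>t\<close> only:
    \<open>F 1\<close> is \<open>R\<close> alone, and \<open>F (Suc T)\<close> holds exactly the
    first \<open>T\<close> losses.\<close>
  define F where "F = (\<lambda>t m. (\<Sum>s = 1..<t. inner m (g s)) + R m)"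
  have F_Suc: "F (Suc t) m = F t m + inner m (g t)" if "t \<ge> 1" for t m
    using that by (simp add: F_def)
  have step: "F t (\<mu> t) + inner (\<mu> t) (g t) \<le> F (Suc t) (\<mu> (Suc t)) + L\<^sup>2 / (2 * \<beta>)"
    if t: "t \<ge> 1" for t
  proof -
    define d where "d = N (\<mu> (Suc t) - \<mu> t)"
    have "F t (\<mu> t) + \<beta> / 2 * d\<^sup>2 \<le> F t (\<mu> (Suc t))"
      using growth[OF t mem[of "Suc t"]] by (simp add: F_def d_def)
    moreover have "- L * d \<le> inner (\<mu> (Suc t)) (g t) - inner (\<mu> t) (g t)"
      using grad[OF t mem[of "Suc t"]] by (simp add: d_def inner_diff_left)
    \<comment> \<open>Completing the square: the constant is the maximum of
      \<open>L * d - \<beta> / 2 * d\<^sup>2\<close>, attained at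
      \<open>d = L / \<beta>\<close>.\<close>
    moreover have "L * d \<le> \<beta> / 2 * d\<^sup>2 + L\<^sup>2 / (2 * \<beta>)"
    proof -
      have "\<beta> / 2 * d\<^sup>2 + L\<^sup>2 / (2 * \<beta>) - L * d = (\<beta> * d - L)\<^sup>2 / (2 * \<beta>)"
        using \<beta> by (simp add: field_simps power2_eq_square)
      also have "\<dots> \<ge> 0" using \<beta> by simp
      finally show ?thesis by simp
    qed
    ultimately show ?thesis using F_Suc[OF t, of "\<mu> (Suc t)"] by linarith
  qed
  have "R (\<mu> 1) + (\<Sum>t = 1..T. inner (\<mu> t) (g t)) \<le> F (Suc T) (\<mu> (Suc T)) + real T * (L\<^sup>2 / (2 * \<beta>))"
  proof (induction T)
    case 0
    then show ?case by (simp add: F_def)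
  next
    case (Suc T)
    have "real (Suc T) * (L\<^sup>2 / (2 * \<beta>)) = real T * (L\<^sup>2 / (2 * \<beta>)) + L\<^sup>2 / (2 * \<beta>)"
      by (simp only: of_nat_Suc distrib_right mult_1 add.commute)
    then show ?case using Suc step[of "Suc T"] by simp
  qed
  \<comment> \<open>The comparator enters only here, through minimality of the iterate that follows
    the last round.\<close>
  also have "F (Suc T) (\<mu> (Suc T)) \<le> F (Suc T) y"
  proof -
    have "0 \<le> \<beta> / 2 * (N (y - \<mu> (Suc T)))\<^sup>2" using \<beta> by simp
    thus ?thesis using growth[of "Suc T" y] y unfolding F_def by simp
  qed
  also have "F (Suc T) y = (\<Sum>t = 1..T. inner y (g t)) + R y"
    by (simp add: F_def atLeastLessThanSuc_atLeastAtMost)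
  finally show ?thesis
    by (simp add: inner_diff_left sum_subtractf)
qed

section \<open>Regret against comparators in the effective domain of the divergence\<close>

theorem theorem4p2:
  fixes \<Theta> :: "'a measure" and \<pi> :: "'a measure"
    and \<eta> L \<alpha> :: real
    and loss :: "nat \<Rightarrow> 'a \<Rightarrow> real"
    and \<phi> :: "real \<Rightarrow> ereal"
    and M :: "(real ^ 'd) set"
    and q :: "real ^ 'd \<Rightarrow> 'a measure"
    and \<mu> g :: "nat \<Rightarrow> real ^ 'd"
    and N :: "real ^ 'd \<Rightarrow> real"
    and T :: nat
  assumes prior: "\<pi> \<in> space (prob_algebra \<Theta>)"
    and eta: "\<eta> > 0"
    and loss_measurable: "\<And>t. t \<ge> 1 \<Longrightarrow> loss t \<in> borel_measurable \<Theta>"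
    and loss_nonneg: "\<And>t \<theta>. t \<ge> 1 \<Longrightarrow> \<theta> \<in> space \<Theta> \<Longrightarrow> loss t \<theta> \<ge> 0"
    and phi_convex: "ereal_strictly_convex_on {0..} \<phi>"
    and phi_one: "\<phi> 1 = 0"
    and phi_bounded_below: "(INF x\<in>{0..}. \<phi> x) > -\<infinity>"
    and M: "closed M" "convex M"
    and q: "\<And>m. m \<in> M \<Longrightarrow> q m \<in> space (prob_algebra \<Theta>)"
    and gradient: "\<And>s. s \<ge> 1 \<Longrightarrow>
      has_gradient_within (\<lambda>m. \<integral>\<theta>. loss s \<theta> \<partial>(q m)) (g s) (\<mu> s) M"
    and argmin: "\<And>t. t \<ge> 1 \<Longrightarrow>
      is_arg_min
        (\<lambda>m. ereal (\<Sum>s = 1..<t. inner m (g s)) + phi_divergence \<phi> (q m) \<pi> / ereal \<eta>)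
        (\<lambda>m. m \<in> M) (\<mu> t)"
    and norm: "is_norm N"
    and L: "L > 0" and alpha: "\<alpha> > 0"
    and expected_loss_finite: "\<And>s m. s \<ge> 1 \<Longrightarrow> m \<in> M \<Longrightarrow> integrable (q m) (loss s)"
    and expected_loss_convex: "\<And>s. s \<ge> 1 \<Longrightarrow> convex_on M (\<lambda>m. \<integral>\<theta>. loss s \<theta> \<partial>(q m))"
    and expected_loss_lipschitz:
      "\<And>s. s \<ge> 1 \<Longrightarrow> lipschitz_wrt N L M (\<lambda>m. \<integral>\<theta>. loss s \<theta> \<partial>(q m))"
    and divergence_strongly_convex:
      "ereal_strongly_convex_on N \<alpha> M (\<lambda>m. phi_divergence \<phi> (q m) \<pi>)"
    and T: "T \<ge> 1"
  shows "ereal (\<Sum>t = 1..T. \<integral>\<theta>. loss t \<theta> \<partial>(q (\<mu> t)))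
    \<le> (INF m\<in>M. ereal (\<Sum>t = 1..T. \<integral>\<theta>. loss t \<theta> \<partial>(q m))
                  + ereal (\<eta> * L\<^sup>2 * real T / \<alpha>)
                  + phi_divergence \<phi> (q m) \<pi> / ereal \<eta>)"
proof (rule INF_greatest)
  fix m assume m: "m \<in> M"
  define D where "D = (\<lambda>m. phi_divergence \<phi> (q m) \<pi>)"
  have D0: "0 \<le> D y" if "y \<in> M" for y
    unfolding D_def using prior q[OF that] phi_convex phi_one phi_bounded_below
    by (intro phi_divergence_nonneg) (auto simp: space_prob_algebra)
  have \<mu>M: "\<mu> t \<in> M" if "t \<ge> 1" for t
    using argmin[OF that] by (simp add: is_arg_min_def)
  define f where "f = (\<lambda>t m. \<integral>\<theta>. loss t \<theta> \<partial>(q m))"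
  show "ereal (\<Sum>t = 1..T. \<integral>\<theta>. loss t \<theta> \<partial>(q (\<mu> t)))
    \<le> ereal (\<Sum>t = 1..T. \<integral>\<theta>. loss t \<theta> \<partial>(q m))
       + ereal (\<eta> * L\<^sup>2 * real T / \<alpha>) + phi_divergence \<phi> (q m) \<pi> / ereal \<eta>"
  \<comment> \<open>A comparator of infinite divergence makes the right-hand side infinite.
    Otherwise \<open>m\<close> witnesses a finite objective, which forces every iterate into the
    effective domain \<open>S\<close>, where the regularizer is real-valued.\<close>
  proof (cases "D m = \<infinity>")
    case True
    then show ?thesis using eta by (simp add: D_def)
  next
    case False
    define S where "S = {y \<in> M. D y < \<infinity>}"
    define r where "r = (\<lambda>y. real_of_ereal (D y))"
    have r: "D y = ereal (r y)" if "y \<in> S" for y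
      using D0[of y] that by (cases "D y") (auto simp: S_def r_def)
    have mS: "m \<in> S" using m False by (auto simp: S_def less_top)
    have opt: "ereal (\<Sum>s = 1..<t. inner (\<mu> t) (g s)) + D (\<mu> t) / ereal \<eta>
        \<le> ereal (\<Sum>s = 1..<t. inner y (g s)) + D y / ereal \<eta>" if "t \<ge> 1" "y \<in> M" for t y
      using argmin[OF that(1)] that(2) by (auto simp: is_arg_min_def D_def not_less)
    have \<mu>S: "\<mu> t \<in> S" if t: "t \<ge> 1" for t
      using opt[OF t m] r[OF mS] \<mu>M[OF t] eta by (cases "D (\<mu> t)") (auto simp: S_def)
    have opt_real: "(\<Sum>s = 1..<t. inner (\<mu> t) (g s)) + r (\<mu> t) / \<eta>
        \<le> (\<Sum>s = 1..<t. inner y (g s)) + r y / \<eta>" if "t \<ge> 1" "y \<in> S" for t y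
      using opt[of t y] that r[OF \<mu>S[OF that(1)]] r[OF that(2)] eta by (auto simp: S_def)
    \<comment> \<open>The extended-valued inequality has a finite right-hand side on
      \<open>S\<close>, so it yields both convexity of \<open>S\<close> and the real
      inequality.\<close>
    have strong: "\<gamma> *\<^sub>R u + (1 - \<gamma>) *\<^sub>R v \<in> S \<and>
        r (\<gamma> *\<^sub>R u + (1 - \<gamma>) *\<^sub>R v)
          \<le> \<gamma> * r u + (1 - \<gamma>) * r v - \<alpha> / 2 * \<gamma> * (1 - \<gamma>) * (N (u - v))\<^sup>2"
      if uv: "u \<in> S" "v \<in> S" and \<gamma>: "0 < \<gamma>" "\<gamma> < 1" for u v \<gamma>
    proof -
      have le: "D (\<gamma> *\<^sub>R u + (1 - \<gamma>) *\<^sub>R v)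
          \<le> ereal (\<gamma> * r u + (1 - \<gamma>) * r v - \<alpha> / 2 * \<gamma> * (1 - \<gamma>) * (N (u - v))\<^sup>2)"
        using divergence_strongly_convex uv \<gamma> r[OF uv(1)] r[OF uv(2)]
        unfolding ereal_strongly_convex_on_def D_def[symmetric] S_def by fastforce
      have "\<gamma> *\<^sub>R u + (1 - \<gamma>) *\<^sub>R v \<in> M"
        using convexD[OF M(2)] uv \<gamma> by (auto simp: S_def)
      hence mem: "\<gamma> *\<^sub>R u + (1 - \<gamma>) *\<^sub>R v \<in> S"
        using le by (auto simp: S_def intro: le_less_trans)
      then show ?thesis using le r[OF mem] by simp
    qed
    \<comment> \<open>The linear losses are affine along the segment, so all curvature comes from
      \<open>r / \<eta>\<close>, with modulus \<open>\<alpha> / \<eta>\<close>; minimality of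
      \<open>\<mu> t\<close> is tested at the points \<open>z\<close> of the segment.\<close>
    have growth: "(\<Sum>s = 1..<t. inner (\<mu> t) (g s)) + r (\<mu> t) / \<eta> + (\<alpha> / \<eta>) / 2 * (N (y - \<mu> t))\<^sup>2
        \<le> (\<Sum>s = 1..<t. inner y (g s)) + r y / \<eta>" if t: "t \<ge> 1" and y: "y \<in> S" for t y
    proof (rule strongly_convex_minimum_growth)
      fix \<gamma> :: real assume \<gamma>: "0 < \<gamma>" "\<gamma> < 1"
      define z where "z = \<gamma> *\<^sub>R y + (1 - \<gamma>) *\<^sub>R \<mu> t"
      have z: "z \<in> S" "r z \<le> \<gamma> * r y + (1 - \<gamma>) * r (\<mu> t) - \<alpha> / 2 * \<gamma> * (1 - \<gamma>) * (N (y - \<mu> t))\<^sup>2"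
        using strong[OF y \<mu>S[OF t] \<gamma>] by (simp_all add: z_def)
      have lin: "(\<Sum>s = 1..<t. inner z (g s))
          = \<gamma> * (\<Sum>s = 1..<t. inner y (g s)) + (1 - \<gamma>) * (\<Sum>s = 1..<t. inner (\<mu> t) (g s))"
        by (simp add: z_def inner_add_left sum.distrib sum_distrib_left)
      have "r z / \<eta> \<le> (\<gamma> * r y + (1 - \<gamma>) * r (\<mu> t) - \<alpha> / 2 * \<gamma> * (1 - \<gamma>) * (N (y - \<mu> t))\<^sup>2) / \<eta>"
        using z(2) eta by (simp add: divide_right_mono)
      also have "\<dots> = \<gamma> * (r y / \<eta>) + (1 - \<gamma>) * (r (\<mu> t) / \<eta>)
          - \<gamma> * (1 - \<gamma>) * ((\<alpha> / \<eta>) / 2 * (N (y - \<mu> t))\<^sup>2)"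
        by (simp add: add_divide_distrib diff_divide_distrib mult_ac)
      finally show "(\<Sum>s = 1..<t. inner (\<mu> t) (g s)) + r (\<mu> t) / \<eta>
          \<le> \<gamma> * ((\<Sum>s = 1..<t. inner y (g s)) + r y / \<eta>)
            + (1 - \<gamma>) * ((\<Sum>s = 1..<t. inner (\<mu> t) (g s)) + r (\<mu> t) / \<eta>)
            - \<gamma> * (1 - \<gamma>) * ((\<alpha> / \<eta>) / 2 * (N (y - \<mu> t))\<^sup>2)"
        using opt_real[OF t z(1)] unfolding lin distrib_left by linarith
    qed
    have grad: "- L * N (y - \<mu> t) \<le> inner (y - \<mu> t) (g t)" if "t \<ge> 1" "y \<in> S" for t y
      using that \<mu>M[OF that(1)] M(2) norm
      by (intro lipschitz_wrt_gradient_bound[OF gradient[OF that(1)] expected_loss_lipschitz[OF that(1)]])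
        (auto simp: S_def)
    \<comment> \<open>Convexity bounds the true regret by that of the linearized losses.\<close>
    have "(\<Sum>t = 1..T. f t (\<mu> t) - f t m) \<le> (\<Sum>t = 1..T. inner (\<mu> t - m) (g t))"
    proof (rule sum_mono)
      fix t assume "t \<in> {1..T}"
      hence t: "t \<ge> 1" by simp
      show "f t (\<mu> t) - f t m \<le> inner (\<mu> t - m) (g t)"
        using convex_on_gradient_ineq[OF gradient[OF t] expected_loss_convex[OF t] \<mu>M[OF t] m]
        by (simp add: f_def inner_diff_left)
    qed
    \<comment> \<open>The regret lemma is applied with regularizer \<open>r / \<eta>\<close> and
      \<open>\<beta> = \<alpha> / \<eta>\<close>.\<close>
    also have "\<dots> \<le> r m / \<eta> - r (\<mu> 1) / \<eta> + real T * (L\<^sup>2 / (2 * (\<alpha> / \<eta>)))"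
      using eta alpha \<mu>S growth grad mS by (intro ftrl_linear_regret[where N = N and S = S]) auto
    \<comment> \<open>The divergence at \<open>\<mu> 1\<close> is dropped by nonnegativity, and the
      factor 1/2 in the stability term is given away.\<close>
    also have "\<dots> \<le> r m / \<eta> + \<eta> * L\<^sup>2 * real T / \<alpha>"
    proof -
      have "0 \<le> r (\<mu> 1) / \<eta>"
        using D0[OF \<mu>M[of 1]] r[OF \<mu>S[of 1]] eta by simp
      moreover have "real T * (L\<^sup>2 / (2 * (\<alpha> / \<eta>))) \<le> \<eta> * L\<^sup>2 * real T / \<alpha>"
        using eta alpha by (simp add: field_simps)
      ultimately show ?thesis by linarith
    qed
    finally have "(\<Sum>t = 1..T. f t (\<mu> t)) \<le> (\<Sum>t = 1..T. f t m) + \<eta> * L\<^sup>2 * real T / \<alpha> + r m / \<eta>"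
      by (simp add: sum_subtractf)
    then show ?thesis
      using r[OF mS] eta by (simp add: f_def D_def)
  qed
qed

end
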